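(* Let $q$ be a prime power, $n$ a positive integer, and let $\mathcal{U}=\{\vec{u}_1,\ldots,\vec{u}_n\}$, $\mathcal{V}=\{\vec{v}_1,\ldots,\vec{v}_n\}$, $\mathcal{W}=\{\vec{w}_1,\ldots,\vec{w}_n\}$ be three (possibly different) ordered bases of $\mathbb{F}_q^n$ over $\mathbb{F}_q$. Let $\mathcal{I}=\{1,\ldots,n\}$ and let $\vec{c}\in\mathbb{F}_q^n\setminus\{\vec{0}\}$. Then the Hamming weight of $\vec{c}$ satisfies $$w_H(\vec{c})\ \geq\ \max\{\#\mathcal{I}' \mid \mathcal{I}'\subseteq\mathcal{I},\ \mathcal{I}' \text{ has the } \mu\text{-property with respect to } m(\vec{c})\}.$$
   Context: Notation. For $\vec{u},\vec{v}\in\mathbb{F}_q^n$, $\vec{u}\ast\vec{v}=(u_1v_1,\ldots,u_nv_n)$ is the componentwise product and $\vec{u}\cdot\vec{v}=\sum_i u_iv_i$ the usual inner product. The function $\bar{\rho}_{\mathcal{W}}:\mathbb{F}_q^n\to\{0,1,\ldots,n\}$ is given by $\bar{\rho}_{\mathcal{W}}(\vec{0})=0$ and, for $\vec{c}\neq\vec{0}$, $\bar{\rho}_{\mathcal{W}}(\vec{c})=i$ if $\vec{c}\in\mathrm{Span}\{\vec{w}_1,\ldots,\vec{w}_i\}\setminus\mathrm{Span}\{\vec{w}_1,\ldots,\vec{w}_{i-1}\}$ (with $\mathrm{Span}\,\emptyset=\{\vec{0}\}$). For $\vec{c}\neq\vec{0}$, $m(\vec{c})$ is the smallest $l\in\mathcal{I}$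 with $\vec{c}\cdot\vec{w}_l\neq 0$. For $\mathcal{I}'\subseteq\mathcal{I}$, a pair $(i,j)\in\mathcal{I}'\times\mathcal{I}$ is one-way well-behaving (OWB) with respect to $\mathcal{I}'$ if $\bar{\rho}_{\mathcal{W}}(\vec{u}_{i'}\ast\vec{v}_j)<\bar{\rho}_{\mathcal{W}}(\vec{u}_i\ast\vec{v}_j)$ for all $i'\in\mathcal{I}'$ with $i'<i$. For $l\in\mathcal{I}$, the set $\mathcal{I}'\subseteq\mathcal{I}$ has the $\mu$-property with respect to $l$ if for all $i\in\mathcal{I}'$ there exists $j\in\mathcal{I}$ such that $(i,j)$ is OWB with respect to $\mathcal{I}'$ and $\bar{\rho}_{\mathcal{W}}(\vec{u}_i\ast\vec{v}_j)=l$. *)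

theory Defs
  imports "HOL-Analysis.Cartesian_Space" "HOL-Computational_Algebra.Primes"
begin

text \<open>
  The space of row vectors over a finite field is \<^typ>\<open>'a::finite_field ^ 'n\<close>, of dimension
  \<^term>\<open>CARD('n)\<close>. The componentwise product is the library product \<open>*\<close> on this type and the
  inner product is \<^const>\<open>scalar_product\<close>. A family of vectors indexed by \<open>1, \<dots>, CARD('n)\<close> is a
  function on \<^typ>\<open>nat\<close>, of which only the values on that range matter.
\<close>

definition ordered_basis :: "(nat \<Rightarrow> 'a::field ^ 'n) \<Rightarrow> bool" where
  "ordered_basis b \<longleftrightarrow>
     inj_on b {1..CARD('n)} \<and>
     vec.independent (b ` {1..CARD('n)}) \<and>
     vec.span (b ` {1..CARD('n)}) = UNIV"

definition hamming_weight :: "'a::zero ^ 'n \<Rightarrow> nat" where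
  "hamming_weight c = card {k. c $ k \<noteq> 0}"

definition rho_bar :: "(nat \<Rightarrow> 'a::field ^ 'n) \<Rightarrow> 'a ^ 'n \<Rightarrow> nat" where
  "rho_bar w c =
     (if c = 0 then 0
      else THE i. i \<in> {1..CARD('n)} \<and>
                  c \<in> vec.span (w ` {1..i}) - vec.span (w ` {1..i - 1}))"

definition m_index :: "(nat \<Rightarrow> 'a::field ^ 'n) \<Rightarrow> 'a ^ 'n \<Rightarrow> nat" where
  "m_index w c = (LEAST l. l \<in> {1..CARD('n)} \<and> scalar_product c (w l) \<noteq> 0)"

definition one_way_well_behaving ::
  "(nat \<Rightarrow> 'a::field ^ 'n) \<Rightarrow> (nat \<Rightarrow> 'a ^ 'n) \<Rightarrow> (nat \<Rightarrow> 'a ^ 'n) \<Rightarrow> nat set \<Rightarrow> nat \<Rightarrow> nat \<Rightarrow> bool"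
where
  "one_way_well_behaving u v w I' i j \<longleftrightarrow>
     i \<in> I' \<and> j \<in> {1..CARD('n)} \<and>
     (\<forall>i'\<in>I'. i' < i \<longrightarrow> rho_bar w (u i' * v j) < rho_bar w (u i * v j))"

definition mu_property ::
  "(nat \<Rightarrow> 'a::field ^ 'n) \<Rightarrow> (nat \<Rightarrow> 'a ^ 'n) \<Rightarrow> (nat \<Rightarrow> 'a ^ 'n) \<Rightarrow> nat \<Rightarrow> nat set \<Rightarrow> bool"
where
  "mu_property u v w l I' \<longleftrightarrow>
     (\<forall>i\<in>I'. \<exists>j\<in>{1..CARD('n)}.
        one_way_well_behaving u v w I' i j \<and> rho_bar w (u i * v j) = l)"

text \<open>The description in \<^const>\<open>rho_bar\<close>, the minimum in \<^const>\<open>m_index\<close>, and the maximum over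
  index sets with \<^const>\<open>mu_property\<close> all denote:\<close>

lemma ex1_rho_bar:
  fixes w :: "nat \<Rightarrow> 'a::field ^ 'n"
  assumes "ordered_basis w" "c \<noteq> 0"
  shows "\<exists>!i. i \<in> {1..CARD('n)} \<and> c \<in> vec.span (w ` {1..i}) - vec.span (w ` {1..i - 1})"
proof (rule ex_ex1I)
  let ?P = "\<lambda>i. c \<in> vec.span (w ` {1..i})"
  have P: "?P (CARD('n))"
    using assms(1) by (simp add: ordered_basis_def)
  have L: "?P (Least ?P)"
    using P by (rule LeastI)
  have le: "Least ?P \<le> CARD('n)"
    using P by (rule Least_le)
  have "Least ?P \<noteq> 0"
  proof
    assume "Least ?P = 0"
    with L have "c \<in> vec.span (w ` {1..0})" by simp
    then show False using assms(2) by simp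
  qed
  moreover from this have "\<not> ?P (Least ?P - 1)"
    by (intro not_less_Least) simp
  ultimately show "\<exists>i. i \<in> {1..CARD('n)} \<and> c \<in> vec.span (w ` {1..i}) - vec.span (w ` {1..i - 1})"
    using L le by (intro exI[of _ "Least ?P"]) auto
next
  fix i j
  assume i: "i \<in> {1..CARD('n)} \<and> c \<in> vec.span (w ` {1..i}) - vec.span (w ` {1..i - 1})"
    and j: "j \<in> {1..CARD('n)} \<and> c \<in> vec.span (w ` {1..j}) - vec.span (w ` {1..j - 1})"
  have mono: "vec.span (w ` {1..a}) \<subseteq> vec.span (w ` {1..b - 1})" if "a < b" for a b :: nat
    using that by (intro vec.span_mono image_mono) auto
  show "i = j"
    using mono[of i j] mono[of j i] i j by (cases i j rule: linorder_cases) auto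
qed

lemma ex_m_index:
  fixes w :: "nat \<Rightarrow> 'a::field ^ 'n"
  assumes "ordered_basis w" "c \<noteq> 0"
  shows "\<exists>l. l \<in> {1..CARD('n)} \<and> scalar_product c (w l) \<noteq> 0"
proof (rule ccontr)
  assume neg: "\<not> ?thesis"
  have "vec.subspace {x. scalar_product c x = 0}"
    by (simp add: vec.subspace_def scalar_product_def distrib_left sum.distrib
        mult.left_commute flip: sum_distrib_left)
  moreover have "w ` {1..CARD('n)} \<subseteq> {x. scalar_product c x = 0}"
    using neg by auto
  ultimately have "vec.span (w ` {1..CARD('n)}) \<subseteq> {x. scalar_product c x = 0}"
    by (rule vec.span_minimal[rotated])
  then have "scalar_product c (axis k 1) = 0" for k
    using assms(1) by (auto simp: ordered_basis_def)
  then have "c $ k = 0" for k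
    by (simp add: scalar_product_def axis_def if_distrib cong: if_cong)
  then show False
    using assms(2) by (simp add: vec_eq_iff)
qed

lemma mu_property_cards:
  fixes u v w :: "nat \<Rightarrow> 'a::field ^ 'n"
  shows "finite {card I' | I'. I' \<subseteq> {1..CARD('n)} \<and> mu_property u v w l I'}"
    and "{card I' | I'. I' \<subseteq> {1..CARD('n)} \<and> mu_property u v w l I'} \<noteq> {}"
proof -
  show "finite {card I' | I'. I' \<subseteq> {1..CARD('n)} \<and> mu_property u v w l I'}"
    by (rule finite_subset[of _ "card ` Pow {1..CARD('n)}"]) auto
  have "mu_property u v w l {}"
    by (simp add: mu_property_def)
  then show "{card I' | I'. I' \<subseteq> {1..CARD('n)} \<and> mu_property u v w l I'} \<noteq> {}"
    by blast
qed

end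

theory Submission
  imports Defs
begin

text \<open>
  For an index set with the property, the vectors \<open>u i * c\<close> are linearly independent and
  supported on the support of \<open>c\<close>, so there are at most as many of them as the Hamming weight
  of \<open>c\<close>. Independence is triangular: with \<open>j\<close> the partner of \<open>i\<close>, the functional
  \<open>x \<mapsto> x \<cdot> v j\<close> maps \<open>u i' * c\<close> to \<open>c \<cdot> (u i' * v j)\<close>, which is nonzero for \<open>i' = i\<close> and zero
  for earlier \<open>i'\<close>, because \<open>c\<close> is orthogonal to the \<open>w k\<close> below \<open>m_index w c\<close> but not to the
  one at that index.
\<close>

lemma subspace_scalar_product_eq_0:
  fixes c :: "'a::field ^ 'n"
  shows "vec.subspace {x. scalar_product c x = 0}"
  by (simp add: vec.subspace_def scalar_product_def distrib_left sum.distrib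
      mult.left_commute flip: sum_distrib_left)

lemma scalar_product_diff_right:
  fixes c :: "'a::field ^ 'n"
  shows "scalar_product c (x - y) = scalar_product c x - scalar_product c y"
  by (simp add: scalar_product_def right_diff_distrib sum_subtractf)

lemma scalar_product_scale_right:
  fixes c :: "'a::field ^ 'n"
  shows "scalar_product c (a *s x) = a * scalar_product c x"
  by (simp add: scalar_product_def sum_distrib_left mult.left_commute)

text \<open>The sum of the products \<open>x $ k * y $ k * z $ k\<close> is symmetric in the three
  vectors. This lets \<open>c\<close> and \<open>v j\<close> trade places, so that facts about
  \<open>c\<close> become facts about the functional given by \<open>v j\<close>.\<close>

lemma scalar_product_mult:
  fixes x y z :: "'a::field ^ 'n"
  shows "scalar_product x (y * z) = scalar_product z (y * x)"
  by (simp add: scalar_product_def mult_ac)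

text \<open>Adding indices in increasing order, the newest functional \<open>g b\<close> kills the
  span of all earlier vectors but not \<open>f b\<close>, so \<open>f b\<close> lies outside that
  span.\<close>

lemma independent_triangular:
  fixes f g :: "nat \<Rightarrow> 'a::field ^ 'n"
  assumes "finite I"
    and "\<And>i. i \<in> I \<Longrightarrow> scalar_product (g i) (f i) \<noteq> 0"
    and "\<And>i i'. i \<in> I \<Longrightarrow> i' \<in> I \<Longrightarrow> i' < i \<Longrightarrow> scalar_product (g i) (f i') = 0"
  shows "inj_on f I \<and> vec.independent (f ` I)"
  using assms
proof (induction I rule: finite_linorder_max_induct)
  case empty
  then show ?case by (simp add: vec.independent_empty)
next
  case (insert b A)
  have "vec.span (f ` A) \<subseteq> {x. scalar_product (g b) x = 0}"
    using insert.hyps(2) insert.prems(2)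
    by (intro vec.span_minimal subspace_scalar_product_eq_0) auto
  then have notin: "f b \<notin> vec.span (f ` A)"
    using insert.prems(1)[of b] by auto
  then have "f b \<notin> f ` A"
    using vec.span_base by blast
  moreover have "inj_on f A \<and> vec.independent (f ` A)"
    using insert.prems by (intro insert.IH) auto
  ultimately show ?case
    using notin by (auto simp: vec.independent_insert)
qed

lemma rho_bar_in_span:
  fixes w :: "nat \<Rightarrow> 'a::field ^ 'n"
  assumes "ordered_basis w" "x \<noteq> 0"
  shows "rho_bar w x \<in> {1..CARD('n)} \<and>
    x \<in> vec.span (w ` {1..rho_bar w x}) - vec.span (w ` {1..rho_bar w x - 1})"
  using theI'[OF ex1_rho_bar[OF assms]] assms(2) by (simp add: rho_bar_def)

lemma m_index:
  fixes w :: "nat \<Rightarrow> 'a::field ^ 'n"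
  assumes "ordered_basis w" "c \<noteq> 0"
  shows "m_index w c \<in> {1..CARD('n)}" and "scalar_product c (w (m_index w c)) \<noteq> 0"
  using LeastI_ex[OF ex_m_index[OF assms]] unfolding m_index_def by auto

lemma scalar_product_span_below_m_index:
  fixes w :: "nat \<Rightarrow> 'a::field ^ 'n"
  assumes "ordered_basis w" "c \<noteq> 0" "l < m_index w c" "x \<in> vec.span (w ` {1..l})"
  shows "scalar_product c x = 0"
proof -
  have "scalar_product c (w k) = 0" if "k \<in> {1..l}" for k
  proof -
    \<comment> \<open>The predicate minimised by \<open>m_index\<close> also requires the index to
      be in range, so minimality gives orthogonality only once \<open>k\<close> is known to be in
      range.\<close>
    have "k < m_index w c" "k \<in> {1..CARD('n)}"
      using that assms(3) m_index(1)[OF assms(1,2)] by auto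
    then show ?thesis
      using not_less_Least[of k] unfolding m_index_def by blast
  qed
  then have "vec.span (w ` {1..l}) \<subseteq> {x. scalar_product c x = 0}"
    by (intro vec.span_minimal subspace_scalar_product_eq_0) auto
  with assms(4) show ?thesis by auto
qed

lemma scalar_product_rho_bar_less:
  fixes w :: "nat \<Rightarrow> 'a::field ^ 'n"
  assumes "ordered_basis w" "c \<noteq> 0" "rho_bar w x < m_index w c"
  shows "scalar_product c x = 0"
proof (cases "x = 0")
  case True
  then show ?thesis by (simp add: scalar_product_def)
next
  case False
  then show ?thesis
    using rho_bar_in_span[OF assms(1)] scalar_product_span_below_m_index[OF assms] by blast
qed

text \<open>Modulo the span of the earlier basis vectors, to which \<open>c\<close> is orthogonal,
  \<open>x\<close> is a nonzero multiple of \<open>w (m_index w c)\<close>.\<close>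

lemma scalar_product_rho_bar_eq:
  fixes w :: "nat \<Rightarrow> 'a::field ^ 'n"
  assumes "ordered_basis w" "c \<noteq> 0" "rho_bar w x = m_index w c"
  shows "scalar_product c x \<noteq> 0"
proof -
  define l where "l = m_index w c"
  \<comment> \<open>Positivity excludes \<open>x = 0\<close>, where \<open>rho_bar\<close> takes the
    default value 0, and makes \<open>l - 1\<close> a true predecessor.\<close>
  have l: "1 \<le> l"
    using m_index(1)[OF assms(1,2)] by (simp add: l_def)
  have "x \<noteq> 0"
    using assms(3) l by (auto simp: rho_bar_def l_def)
  then have x: "x \<in> vec.span (w ` {1..l})" "x \<notin> vec.span (w ` {1..l - 1})"
    using rho_bar_in_span[OF assms(1) \<open>x \<noteq> 0\<close>] assms(3) by (simp_all add: l_def)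
  have "{1..l} = insert l {1..l - 1}"
    using l by auto
  then obtain a where a: "x - a *s w l \<in> vec.span (w ` {1..l - 1})"
    using x(1) by (auto simp: vec.span_insert)
  have "a \<noteq> 0"
    using a x(2) by auto
  moreover have "scalar_product c (x - a *s w l) = 0"
    using a l by (intro scalar_product_span_below_m_index[OF assms(1,2), of "l - 1"])
      (auto simp: l_def)
  ultimately show ?thesis
    using m_index(2)[OF assms(1,2)]
    by (simp add: scalar_product_diff_right scalar_product_scale_right l_def)
qed

lemma card_le_hamming_weight:
  fixes u v w :: "nat \<Rightarrow> 'a::field ^ 'n"
  assumes w: "ordered_basis w" and c: "c \<noteq> 0"
    and "finite I" and mu: "mu_property u v w (m_index w c) I"
  shows "card I \<le> hamming_weight c"
proof -
  define f where "f i = u i * c" for i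
  obtain j where j: "\<And>i. i \<in> I \<Longrightarrow> one_way_well_behaving u v w I i (j i)"
      "\<And>i. i \<in> I \<Longrightarrow> rho_bar w (u i * v (j i)) = m_index w c"
    using mu unfolding mu_property_def by metis
  have "inj_on f I \<and> vec.independent (f ` I)"
  proof (rule independent_triangular[where g = "\<lambda>i. v (j i)"])
    show "scalar_product (v (j i)) (f i) \<noteq> 0" if "i \<in> I" for i
      using scalar_product_rho_bar_eq[OF w c j(2)[OF that]]
      by (simp add: f_def scalar_product_mult[of "v (j i)"])
    show "scalar_product (v (j i)) (f i') = 0" if "i \<in> I" "i' \<in> I" "i' < i" for i i'
    proof -
      have "rho_bar w (u i' * v (j i)) < m_index w c"
        using j[OF that(1)] that unfolding one_way_well_behaving_def by auto
      from scalar_product_rho_bar_less[OF w c this] show ?thesis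
        by (simp add: f_def scalar_product_mult[of "v (j i)"])
    qed
  qed fact
  then have inj: "inj_on f I" and indep: "vec.independent (f ` I)"
    by simp_all
  have "card I = card (f ` I)"
    using inj by (simp add: card_image)
  \<comment> \<open>The subspace of all vectors supported on the support of \<open>c\<close>
    contains every \<open>u i * c\<close>, and its dimension is the size of that support.\<close>
  also have "card (f ` I) \<le> vec.dim {x :: 'a ^ 'n. \<forall>k. k \<notin> {k. c $ k \<noteq> 0} \<longrightarrow> x $ k = 0}"
    by (intro vec.independent_card_le_dim indep) (auto simp: f_def)
  also have "\<dots> = hamming_weight c"
    unfolding hamming_weight_def by (rule dim_substandard_cart)
  finally show ?thesis .
qed

theorem theorem7:
  fixes u v w :: "nat \<Rightarrow> 'a::finite_field ^ 'n"
    and c :: "'a ^ 'n"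
  assumes "ordered_basis u" and "ordered_basis v" and "ordered_basis w"
    and "c \<noteq> 0"
  shows "hamming_weight c \<ge>
           Max {card I' | I'. I' \<subseteq> {1..CARD('n)} \<and> mu_property u v w (m_index w c) I'}"
proof (rule Max.boundedI[OF mu_property_cards])
  fix a
  assume "a \<in> {card I' | I'. I' \<subseteq> {1..CARD('n)} \<and> mu_property u v w (m_index w c) I'}"
  then show "a \<le> hamming_weight c"
    using card_le_hamming_weight[OF assms(3,4)] finite_subset[OF _ finite_atLeastAtMost]
    by blast
qed

end
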